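(* Let $G_1$, $G_2$ be Riemannian metrics on a surface. Suppose they are proportional at an isolated point $q_0$ and geodesically equivalent in a neighborhood of $q_0$. Let $F$ be a Dini transition function of the ordered pair $(G_1,G_2)$ from some isothermal coordinates of $G_1$ around $q_0$. Then $(F')^2$ is a single-valued holomorphic function on a punctured neighborhood of $q_0$ and has a pole of order $1$ or $2$ at $q_0$. Moreover, if the pole has order $2$, then the coefficient of $(z-z(q_0))^{-2}$ in its Laurent expansion at $q_0$ is real.
   Context: Isothermal coordinates $(x,y)$ for a Riemannian metric $G$ on a surface are local coordinates in which $G=\mu(x,y)(dx^2+dy^2)$; put $z=x+iy$. For Riemannian metrics $G_1,G_2$ on a surface that are geodesically equivalent near a point and non-proportional there, Dini coordinates of the ordered pair $(G_1,G_2)$ are local coordinates $(x_1,x_2)$ together with one-variable functions $\beta_1(x_1)<\beta_2(x_2)$ such that $$G_1=\Big(\tfrac1{\beta_1(x_1)}-\tfrac1{\beta_2(x_2)}\Big)(dx_1^2+dx_2^2),$$ $$G_2=\beta_1(x_1)\beta_2(x_2)\Big(\tfrac1{\beta_1(x_1)}-\tfrac1{\beta_2(x_2)}\Big)\big(\beta_1(x_1)dx_1^2+\beta_2(x_2)dx_2^2\big).$$ Such coordinates exist near any point where the metrics are geodesically equivalent and non-proportional. Fix isothermal coordinates $(x,y)$ of $G_1$ on a neighborhood $B$ of $q_0$ in which the metrics are geodesically equivalent. A Dini transition function is a (possibly multivalued) analytic function $F$ on $B\setminus\{q_0\}$, obtained by analytic continuation, each of whose function elements $u+iv$ defines the transition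 from $(x,y)$ to Dini coordinates $(u,v)$ of $(G_1,G_2)$ having the same orientation as $(x,y)$. *)

theory Defs
  imports "HOL-Complex_Analysis.Complex_Analysis"
begin

(* Everything is expressed in a fixed isothermal chart z = x + i y of G1 around q0,
   identifying a neighbourhood of q0 with an open subset of the complex plane
   (tangent vectors are complex numbers a = dx(a) + i dy(a)). *)

type_synonym metric = "complex \<Rightarrow> complex \<Rightarrow> complex \<Rightarrow> real"

definition coef_metric :: "(complex \<Rightarrow> real) \<Rightarrow> (complex \<Rightarrow> real) \<Rightarrow> (complex \<Rightarrow> real) \<Rightarrow> metric" where
  "coef_metric E F H = (\<lambda>p a b. E p * Re a * Re b + F p * (Re a * Im b + Im a * Re b) + H p * Im a * Im b)"

fun Ck_on :: "nat \<Rightarrow> complex set \<Rightarrow> (complex \<Rightarrow> real) \<Rightarrow> bool" where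
  "Ck_on 0 U f = continuous_on U f"
| "Ck_on (Suc k) U f =
     (\<exists>Df. (\<forall>p\<in>U. (f has_derivative Df p) (at p)) \<and>
           Ck_on k U (\<lambda>p. Df p 1) \<and> Ck_on k U (\<lambda>p. Df p \<i>))"

definition smooth_fun :: "complex set \<Rightarrow> (complex \<Rightarrow> real) \<Rightarrow> bool" where
  "smooth_fun U f \<longleftrightarrow> (\<forall>k. Ck_on k U f)"

definition riemannian_metric :: "complex set \<Rightarrow> (complex \<Rightarrow> real) \<Rightarrow> (complex \<Rightarrow> real) \<Rightarrow> (complex \<Rightarrow> real) \<Rightarrow> bool" where
  "riemannian_metric U E F H \<longleftrightarrow> smooth_fun U E \<and> smooth_fun U F \<and> smooth_fun U H \<and>
     (\<forall>p\<in>U. \<forall>a. a \<noteq> 0 \<longrightarrow> coef_metric E F H p a a > 0)"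

(* geodesic of g in U, parametrised on an open interval I: twice differentiable curve
   satisfying the geodesic equation in coordinates (index lowered by g):
   d/dt g(gamma', e_k) = 1/2 (partial_k g)(gamma', gamma'),  e_k in {1, i}. *)
definition is_geodesic :: "metric \<Rightarrow> complex set \<Rightarrow> real set \<Rightarrow> (real \<Rightarrow> complex) \<Rightarrow> bool" where
  "is_geodesic g U I \<gamma> \<longleftrightarrow> open I \<and> is_interval I \<and> \<gamma> ` I \<subseteq> U \<and>
     (\<exists>\<gamma>' \<gamma>''. \<forall>t\<in>I. (\<gamma> has_vector_derivative \<gamma>' t) (at t) \<and>
        (\<gamma>' has_vector_derivative \<gamma>'' t) (at t) \<and>
        (\<forall>k\<in>{1, \<i>}. \<exists>D.
            ((\<lambda>s. g (\<gamma> t + of_real s * k) (\<gamma>' t) (\<gamma>' t)) has_real_derivative D) (at 0) \<and>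
            ((\<lambda>s. g (\<gamma> s) (\<gamma>' s) k) has_real_derivative D / 2) (at t)))"

definition geod_sub :: "metric \<Rightarrow> metric \<Rightarrow> complex set \<Rightarrow> bool" where
  "geod_sub g1 g2 U \<longleftrightarrow> (\<forall>I \<gamma>. is_geodesic g1 U I \<gamma> \<longrightarrow>
     (\<exists>J \<sigma> \<sigma>'. bij_betw \<sigma> J I \<and>
        (\<forall>t\<in>J. (\<sigma> has_real_derivative \<sigma>' t) (at t) \<and> \<sigma>' t \<noteq> 0) \<and>
        is_geodesic g2 U J (\<gamma> \<circ> \<sigma>)))"

definition geod_equiv :: "metric \<Rightarrow> metric \<Rightarrow> complex set \<Rightarrow> bool" where
  "geod_equiv g1 g2 U \<longleftrightarrow> geod_sub g1 g2 U \<and> geod_sub g2 g1 U"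

definition proportional_at :: "metric \<Rightarrow> metric \<Rightarrow> complex \<Rightarrow> bool" where
  "proportional_at g1 g2 p \<longleftrightarrow> (\<exists>c. \<forall>a b. g2 p a b = c * g1 p a b)"

(* Phi : P -> C, (u,v) = (Re Phi, Im Phi), is a transition from (x,y) to Dini coordinates of
   (g1,g2) with the same orientation (Phi holomorphic, locally diffeomorphic, injective). *)
definition dini_chart :: "metric \<Rightarrow> metric \<Rightarrow> complex set \<Rightarrow> (complex \<Rightarrow> complex) \<Rightarrow> bool" where
  "dini_chart g1 g2 P \<Phi> \<longleftrightarrow> open P \<and> \<Phi> holomorphic_on P \<and> inj_on \<Phi> P \<and>
     (\<forall>p\<in>P. deriv \<Phi> p \<noteq> 0) \<and>
     (\<exists>\<beta>1 \<beta>2 :: real \<Rightarrow> real. \<forall>p\<in>P.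
        \<beta>1 (Re (\<Phi> p)) < \<beta>2 (Im (\<Phi> p)) \<and>
        (\<forall>a. let u = Re (\<Phi> p); v = Im (\<Phi> p);
                 du = Re (deriv \<Phi> p * a); dv = Im (deriv \<Phi> p * a) in
           g1 p a a = (1 / \<beta>1 u - 1 / \<beta>2 v) * (du\<^sup>2 + dv\<^sup>2) \<and>
           g2 p a a = \<beta>1 u * \<beta>2 v * (1 / \<beta>1 u - 1 / \<beta>2 v) * (\<beta>1 u * du\<^sup>2 + \<beta>2 v * dv\<^sup>2)))"

(* A multivalued analytic function on the punctured disc ball z0 r - {z0} is represented by a
   holomorphic function f on the universal cover {w. Re w < ln r}, covering map w |-> z0 + exp w.
   The function element of f over the sheet V (on which the covering map is injective): *)
definition elem :: "(complex \<Rightarrow> complex) \<Rightarrow> complex \<Rightarrow> complex set \<Rightarrow> complex \<Rightarrow> complex" where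
  "elem f z0 V = f \<circ> inv_into V (\<lambda>w. z0 + exp w)"

definition dini_transition_function ::
  "metric \<Rightarrow> metric \<Rightarrow> complex \<Rightarrow> real \<Rightarrow> (complex \<Rightarrow> complex) \<Rightarrow> bool" where
  "dini_transition_function g1 g2 z0 r f \<longleftrightarrow>
     f holomorphic_on {w. Re w < ln r} \<and>
     (\<forall>w. Re w < ln r \<longrightarrow> (\<exists>V. open V \<and> w \<in> V \<and> V \<subseteq> {w. Re w < ln r} \<and>
        inj_on (\<lambda>w'. z0 + exp w') V \<and>
        dini_chart g1 g2 ((\<lambda>w'. z0 + exp w') ` V) (elem f z0 V)))"

end

theory Submission
  imports Defs
begin

text \<open>
  Write \<open>G\<^sub>2\<close> as \<open>A |a|\<^sup>2 + Re (B a\<^sup>2)\<close> in the isothermal coordinate. In Dini coordinates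
  \<open>det G\<^sub>2 / det G\<^sub>1 = (\<beta>\<^sub>1 \<beta>\<^sub>2)\<^sup>3\<close>, and comparing the two expressions for \<open>G\<^sub>2\<close> gives
  \<open>1 / F'\<^sup>2 = Q\<close> with \<open>Q = - 2 cnj B / ((\<beta>\<^sub>1 \<beta>\<^sub>2)\<^sup>2 \<mu>\<^sup>2)\<close>. The right-hand side is single-valued, continuous
  on the whole disc and vanishes exactly where the metrics are proportional, so \<open>Q\<close> is holomorphic
  and \<open>F'\<^sup>2 = 1 / Q\<close> has a pole.

  To bound the order \<open>n\<close> of the zero of \<open>Q\<close>, let \<open>\<Psi>\<close> be a local inverse of \<open>F\<close>. The conformal factor
  \<open>(\<mu> \<circ> \<Psi>) |\<Psi>'|\<^sup>2\<close> of \<open>G\<^sub>1\<close> in Dini coordinates is a function of \<open>u\<close> minus a function of \<open>v\<close>, so its mixed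
  derivative vanishes; in terms of \<open>z\<close> this reads
  \<open>Im (\<mu>\<^sub>z\<^sub>z Q + 3/2 \<mu>\<^sub>z Q' + 1/2 \<mu> Q'') = 0\<close>. If \<open>n \<ge> 2\<close> and \<open>Q \<sim> c (z - z\<^sub>0)^n\<close>, dividing by \<open>|z - z\<^sub>0|^(n - 2)\<close>
  and letting \<open>z \<rightarrow> z\<^sub>0\<close> along rays shows that \<open>c (z - z\<^sub>0)^(n - 2)\<close> is real in all directions, hence
  \<open>n = 2\<close> and \<open>c\<close> is real.
\<close>

section \<open>Function elements on the universal cover\<close>

text \<open>Chain rule through the holomorphic local inverse of the covering map. The value does not
  involve the sheet \<open>V\<close>, and \<open>f\<close> need only be differentiable at
  \<open>w\<close> itself, so any two sheets through \<open>w\<close> can be compared.\<close>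

lemma elem_deriv:
  assumes V: "open V" "w \<in> V" "inj_on (\<lambda>w. z0 + exp w) V"
    and f: "f field_differentiable (at w)"
  shows "deriv (elem f z0 V) (z0 + exp w) = deriv f w / exp w"
proof -
  let ?e = "\<lambda>w. z0 + exp w"
  have hol: "?e holomorphic_on V"
    by (intro holomorphic_intros)
  obtain g where g: "g holomorphic_on (?e ` V)"
      "\<And>z. z \<in> V \<Longrightarrow> deriv ?e z * deriv g (?e z) = 1" "\<And>z. z \<in> V \<Longrightarrow> g (?e z) = z"
    using holomorphic_has_inverse[OF hol V(1,3)] by blast
  have op: "open (?e ` V)"
    using open_mapping_thm3[OF hol V(1,3)] .
  have de: "deriv ?e w = exp w"
    by (intro DERIV_imp_deriv) (auto intro!: derivative_eq_intros)
  have mem: "?e w \<in> ?e ` V" using V(2) by blast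
  have "deriv g (?e w) = 1 / exp w"
    using g(2)[OF V(2)] unfolding de by (simp add: field_simps)
  moreover have "(g has_field_derivative deriv g (?e w)) (at (?e w))"
    using g(1) op mem by (rule holomorphic_derivI)
  ultimately have dg: "(g has_field_derivative 1 / exp w) (at (?e w))" by simp
  have "(f has_field_derivative deriv f w) (at (g (?e w)))"
    using f g(3)[OF V(2)] by (simp add: DERIV_deriv_iff_field_differentiable)
  from DERIV_chain[OF this dg]
  have "((f \<circ> g) has_field_derivative deriv f w / exp w) (at (?e w))" by simp
  moreover have "(f \<circ> g) p = elem f z0 V p" if "p \<in> ?e ` V" for p
    using that by (auto simp: elem_def g(3) inv_into_f_f[OF V(3)])
  ultimately have "(elem f z0 V has_field_derivative deriv f w / exp w) (at (?e w))"
    using has_field_derivative_transform_within_open[OF _ op mem] by blast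
  then show ?thesis by (rule DERIV_imp_deriv)
qed

section \<open>Wirtinger calculus for the conformal factor\<close>

text \<open>\<open>m = \<partial>f/\<partial>z\<close>, \<open>m2 = \<partial>\<^sup>2f/\<partial>z\<^sup>2\<close>, \<open>m11 = \<partial>\<^sup>2f/\<partial>z\<partial>(cnj z)\<close> in Wirtinger notation.\<close>

lemma Ck_on_2_wirtinger:
  assumes "Ck_on 2 U f"
  obtains m m2 m11 :: "complex \<Rightarrow> complex"
  where "\<And>p. p \<in> U \<Longrightarrow> (f has_derivative (\<lambda>a. 2 * Re (m p * a))) (at p)"
    and "\<And>p. p \<in> U \<Longrightarrow> (m has_derivative (\<lambda>a. m2 p * a + m11 p * cnj a)) (at p)"
    and "continuous_on U m2"
proof -
  have step: "\<exists>D. (\<forall>p\<in>U. (f has_derivative D p) (at p)) \<and> Ck_on k U (\<lambda>p. D p 1) \<and> Ck_on k U (\<lambda>p. D p \<i>)"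
    if "Ck_on (Suc k) U f" for k f
    using that by (simp only: Ck_on.simps)
  from assms have "Ck_on (Suc (Suc 0)) U f" by (simp only: numeral_2_eq_2)
  from step[OF this] obtain D where
    D: "\<And>p. p \<in> U \<Longrightarrow> (f has_derivative D p) (at p)"
    and C: "Ck_on (Suc 0) U (\<lambda>p. D p 1)" "Ck_on (Suc 0) U (\<lambda>p. D p \<i>)" by metis
  from step[OF C(1)] obtain D1 where
    D1: "\<And>p. p \<in> U \<Longrightarrow> ((\<lambda>p. D p 1) has_derivative D1 p) (at p)"
    and C1: "Ck_on 0 U (\<lambda>p. D1 p 1)" "Ck_on 0 U (\<lambda>p. D1 p \<i>)" by metis
  from step[OF C(2)] obtain D2 where
    D2: "\<And>p. p \<in> U \<Longrightarrow> ((\<lambda>p. D p \<i>) has_derivative D2 p) (at p)"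
    and C2: "Ck_on 0 U (\<lambda>p. D2 p 1)" "Ck_on 0 U (\<lambda>p. D2 p \<i>)" by metis
  note cont = C1[unfolded Ck_on.simps(1)] C2[unfolded Ck_on.simps(1)]
  have lin: "L a = Re a * L 1 + Im a * L \<i>" if "linear L" for L :: "complex \<Rightarrow> real" and a
  proof -
    have "L a = L (Re a *\<^sub>R 1 + Im a *\<^sub>R \<i>)"
      by (rule arg_cong[where f = L]) (simp add: complex_eq_iff)
    also have "\<dots> = Re a * L 1 + Im a * L \<i>"
      using that by (simp add: linear_add linear_cmul)
    finally show ?thesis .
  qed
  define m where "m p = Complex (D p 1 / 2) (- D p \<i> / 2)" for p
  define m2 where "m2 p = Complex ((D1 p 1 - D2 p \<i>) / 4) (- (D2 p 1 + D1 p \<i>) / 4)" for p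
  \<comment> \<open>Symmetry of mixed partials is not invoked, so \<open>m11\<close> keeps a formal
    imaginary part that symmetry would cancel.\<close>
  define m11 where "m11 p = Complex ((D1 p 1 + D2 p \<i>) / 4) ((D1 p \<i> - D2 p 1) / 4)" for p
  show thesis
  proof
    fix p assume p: "p \<in> U"
    have "D p = (\<lambda>a. 2 * Re (m p * a))"
    proof
      show "D p a = 2 * Re (m p * a)" for a
        unfolding lin[OF has_derivative_linear[OF D[OF p]], of a] by (simp add: m_def)
    qed
    with D[OF p] show "(f has_derivative (\<lambda>a. 2 * Re (m p * a))) (at p)" by simp
    have m_eq: "m = (\<lambda>p. of_real (D p 1) / 2 - \<i> * of_real (D p \<i>) / 2)"
      by (auto simp: m_def fun_eq_iff complex_eq_iff)
    have "(m has_derivative (\<lambda>a. of_real (D1 p a) / 2 - \<i> * of_real (D2 p a) / 2)) (at p)"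
      unfolding m_eq by (auto intro!: derivative_eq_intros D1[OF p] D2[OF p])
    moreover have "of_real (D1 p a) / 2 - \<i> * of_real (D2 p a) / 2 = m2 p * a + m11 p * cnj a" for a
      unfolding lin[OF has_derivative_linear[OF D1[OF p]], of a]
        lin[OF has_derivative_linear[OF D2[OF p]], of a]
      by (simp add: m2_def m11_def complex_eq_iff field_simps)
    ultimately show "(m has_derivative (\<lambda>a. m2 p * a + m11 p * cnj a)) (at p)" by simp
  next
    show "continuous_on U m2"
      unfolding m2_def Complex_eq by (intro continuous_intros cont) auto
  qed
qed

text \<open>Since \<open>l\<close> is the zeta-derivative of \<open>L\<close>, the imaginary part of
  \<open>\<alpha>\<close> is a multiple of the mixed second derivative, which vanishes for a
  function of u minus a function of v. As \<open>\<beta>\<close> is not known to be real, both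
  orders of mixed differentiation enter.\<close>

lemma separated_Im_wirtinger:
  fixes L :: "complex \<Rightarrow> real"
  assumes W: "open W" "\<zeta>0 \<in> W"
    and sep: "\<And>\<zeta>. \<zeta> \<in> W \<Longrightarrow> L \<zeta> = b1 (Re \<zeta>) - b2 (Im \<zeta>)"
    and d1: "\<And>\<zeta>. \<zeta> \<in> W \<Longrightarrow> (L has_derivative (\<lambda>a. 2 * Re (l \<zeta> * a))) (at \<zeta>)"
    and d2: "(l has_derivative (\<lambda>a. \<alpha> * a + \<beta> * cnj a)) (at \<zeta>0)"
  shows "Im \<alpha> = 0"
proof -
  obtain e where e: "e > 0" "ball \<zeta>0 e \<subseteq> W"
    using W by (meson openE)
  have dir: "((\<lambda>t::real. L (\<zeta> + of_real t * k)) has_real_derivative 2 * Re (l \<zeta> * k)) (at 0)"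
    if "\<zeta> \<in> W" for \<zeta> k
  proof -
    have "((\<lambda>t::real. \<zeta> + of_real t * k) has_derivative (\<lambda>t. of_real t * k)) (at 0)"
      by (auto intro!: derivative_eq_intros)
    moreover have "(L has_derivative (\<lambda>a. 2 * Re (l \<zeta> * a))) (at (\<zeta> + of_real 0 * k))"
      using d1[OF that] by simp
    ultimately have "((\<lambda>t::real. L (\<zeta> + of_real t * k)) has_derivative
        (\<lambda>t. 2 * Re (l \<zeta> * (of_real t * k)))) (at 0)"
      by (rule has_derivative_compose)
    then show ?thesis
      unfolding has_field_derivative_def
      by (rule has_derivative_eq_rhs) (auto simp: fun_eq_iff algebra_simps)
  qed
  have dir_l: "((\<lambda>s::real. l (\<zeta>0 + of_real s * k)) has_vector_derivative \<alpha> * k + \<beta> * cnj k) (at 0)"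
    for k
  proof -
    have "((\<lambda>t::real. \<zeta>0 + of_real t * k) has_derivative (\<lambda>t. of_real t * k)) (at 0)"
      by (auto intro!: derivative_eq_intros)
    moreover have "(l has_derivative (\<lambda>a. \<alpha> * a + \<beta> * cnj a)) (at (\<zeta>0 + of_real 0 * k))"
      using d2 by simp
    ultimately have "((\<lambda>t::real. l (\<zeta>0 + of_real t * k)) has_derivative
        (\<lambda>t. \<alpha> * (of_real t * k) + \<beta> * cnj (of_real t * k))) (at 0)"
      by (rule has_derivative_compose)
    then show ?thesis
      unfolding has_vector_derivative_def
      by (rule has_derivative_eq_rhs) (auto simp: fun_eq_iff algebra_simps scaleR_conv_of_real)
  qed
  \<comment> \<open>\<open>\<partial>L/\<partial>k\<close> depends on one coordinate only, so it is constant along the other direction \<open>k'\<close>.\<close>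
  have const: "Re (l (\<zeta>0 + of_real s * k') * k) = Re (l \<zeta>0 * k)"
    if k: "k = 1 \<and> k' = \<i> \<or> k = \<i> \<and> k' = 1" and s: "\<bar>s\<bar> < e" for s k k'
  proof -
    let ?\<zeta> = "\<zeta>0 + of_real s * k'"
    have nk: "cmod k' = 1" "cmod k = 1" using k by auto
    have in1: "\<zeta>0 + of_real s * k' + of_real t * k \<in> W" if "\<bar>t\<bar> < e - \<bar>s\<bar>" for t
    proof -
      have "cmod (of_real s * k' + of_real t * k) \<le> \<bar>s\<bar> + \<bar>t\<bar>"
        using norm_triangle_ineq[of "of_real s * k'" "of_real t * k"] nk by (simp add: norm_mult)
      then have "dist \<zeta>0 (\<zeta>0 + of_real s * k' + of_real t * k) < e"
        using that norm_minus_cancel[of "of_real s * k' + of_real t * k"]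
        by (simp add: dist_norm)
      then show ?thesis using e by auto
    qed
    have in2: "\<zeta>0 + of_real t * k \<in> W" if "\<bar>t\<bar> < e - \<bar>s\<bar>" for t
    proof -
      have "dist \<zeta>0 (\<zeta>0 + of_real t * k) < e"
        using that nk by (simp add: dist_norm norm_mult)
      then show ?thesis using e by auto
    qed
    have diff: "L (?\<zeta> + of_real t * k) = L (\<zeta>0 + of_real t * k) + (L ?\<zeta> - L \<zeta>0)"
      if "\<bar>t\<bar> < e - \<bar>s\<bar>" for t
    proof -
      have "?\<zeta> \<in> W" "\<zeta>0 \<in> W" using in1[of 0] in2[of 0] s by auto
      then show ?thesis
        using sep[OF in1[OF that]] sep[OF in2[OF that]] sep[of ?\<zeta>] sep[of \<zeta>0] k by auto
    qed
    have "((\<lambda>t. L (\<zeta>0 + of_real t * k) + (L ?\<zeta> - L \<zeta>0)) has_real_derivative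
        2 * Re (l \<zeta>0 * k)) (at 0)"
      using DERIV_add[OF dir[OF W(2), of k] DERIV_const[of "L ?\<zeta> - L \<zeta>0"]] by simp
    then have "((\<lambda>t. L (?\<zeta> + of_real t * k)) has_real_derivative 2 * Re (l \<zeta>0 * k)) (at 0)"
    proof (rule has_field_derivative_transform_within_open)
      show "open (ball 0 (e - \<bar>s\<bar>))" "0 \<in> ball 0 (e - \<bar>s\<bar>)" using s by auto
    qed (use diff in auto)
    moreover have "((\<lambda>t. L (?\<zeta> + of_real t * k)) has_real_derivative 2 * Re (l ?\<zeta> * k)) (at 0)"
      using in1[of 0] s by (intro dir) auto
    ultimately show ?thesis using DERIV_unique by fastforce
  qed
  have zero: "Re ((\<alpha> * k' + \<beta> * cnj k') * k) = 0"
    if k: "k = 1 \<and> k' = \<i> \<or> k = \<i> \<and> k' = 1" for k k'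
  proof -
    have "((\<lambda>s::real. l (\<zeta>0 + of_real s * k') * k) has_vector_derivative (\<alpha> * k' + \<beta> * cnj k') * k) (at 0)"
      by (intro has_vector_derivative_mult_left dir_l)
    then have "((\<lambda>s::real. Re (l (\<zeta>0 + of_real s * k') * k)) has_real_derivative
        Re ((\<alpha> * k' + \<beta> * cnj k') * k)) (at 0)"
      by (rule has_field_derivative_Re)
    moreover have "((\<lambda>s::real. Re (l (\<zeta>0 + of_real s * k') * k)) has_real_derivative 0) (at 0)"
    proof (rule has_field_derivative_transform_within_open[where f = "\<lambda>_. Re (l \<zeta>0 * k)"])
      show "open (ball 0 e)" "0 \<in> ball 0 e" using e by auto
    qed (use const[OF k] in auto)
    ultimately show ?thesis by (rule DERIV_unique)
  qed
  \<comment> \<open>The two orders give Im \<open>\<alpha>\<close> = Im \<open>\<beta>\<close> and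
    Im \<open>\<alpha>\<close> = - Im \<open>\<beta>\<close>.\<close>
  from zero[of 1 \<i>] zero[of \<i> 1] show ?thesis by simp
qed

text \<open>The expression under \<open>Im\<close> is the second zeta-derivative of \<open>\<mu>
  (\<Psi> \<zeta>) * (cmod (deriv \<Psi> \<zeta>))\<^sup>2\<close>. The antiholomorphic factor
  \<open>cnj (deriv \<Psi> \<zeta>)\<close> is constant for d/dzeta and therefore stays
  outside.\<close>

lemma liouville_form_Im:
  fixes \<mu> :: "complex \<Rightarrow> real"
  assumes W: "open W" "\<zeta> \<in> W" and \<Psi>: "\<Psi> holomorphic_on W" "\<Psi> ` W \<subseteq> U"
    and sep: "\<And>\<zeta>. \<zeta> \<in> W \<Longrightarrow> \<mu> (\<Psi> \<zeta>) * (cmod (deriv \<Psi> \<zeta>))\<^sup>2 = b1 (Re \<zeta>) - b2 (Im \<zeta>)"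
    and m: "\<And>p. p \<in> U \<Longrightarrow> (\<mu> has_derivative (\<lambda>a. 2 * Re (m p * a))) (at p)"
    and m2: "\<And>p. p \<in> U \<Longrightarrow> (m has_derivative (\<lambda>a. m2 p * a + m11 p * cnj a)) (at p)"
  shows "Im ((m2 (\<Psi> \<zeta>) * deriv \<Psi> \<zeta> ^ 3 + 3 * m (\<Psi> \<zeta>) * deriv \<Psi> \<zeta> * deriv (deriv \<Psi>) \<zeta>
      + of_real (\<mu> (\<Psi> \<zeta>)) * deriv (deriv (deriv \<Psi>)) \<zeta>) * cnj (deriv \<Psi> \<zeta>)) = 0"
proof -
  define P1 where "P1 = deriv \<Psi>"
  define P2 where "P2 = deriv P1"
  define P3 where "P3 = deriv P2"
  have h1: "P1 holomorphic_on W" and h2: "P2 holomorphic_on W"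
    unfolding P1_def P2_def using \<Psi>(1) W(1) by (auto intro!: holomorphic_deriv)
  have der: "(\<Psi> has_derivative (\<lambda>a. P1 z * a)) (at z)"
      "(P1 has_derivative (\<lambda>a. P2 z * a)) (at z)" "(P2 has_derivative (\<lambda>a. P3 z * a)) (at z)"
    if "z \<in> W" for z
    using holomorphic_derivI[OF \<Psi>(1) W(1) that] holomorphic_derivI[OF h1 W(1) that]
      holomorphic_derivI[OF h2 W(1) that]
    by (auto simp: P1_def P2_def P3_def has_field_derivative_def)
  have cder: "((\<lambda>z. cnj (P1 z)) has_derivative (\<lambda>a. cnj (P2 z * a))) (at z)" if "z \<in> W" for z
    by (rule has_derivative_cnj[OF der(2)[OF that]])
  have \<mu>der: "((\<lambda>z. \<mu> (\<Psi> z)) has_derivative (\<lambda>a. 2 * Re (m (\<Psi> z) * (P1 z * a)))) (at z)"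
    if "z \<in> W" for z
    using \<Psi>(2) that by (intro has_derivative_compose[OF der(1)[OF that]] m) auto
  have mder: "((\<lambda>z. m (\<Psi> z)) has_derivative
      (\<lambda>a. m2 (\<Psi> z) * (P1 z * a) + m11 (\<Psi> z) * cnj (P1 z * a))) (at z)" if "z \<in> W" for z
    using \<Psi>(2) that by (intro has_derivative_compose[OF der(1)[OF that]] m2) auto
  \<comment> \<open>This is the zeta-derivative of \<open>L\<close>. The \<open>\<beta>\<close>
    supplied below is the derivative of \<open>l\<close> in the conjugate variable, which completes
    its real differential.\<close>
  define l where "l z = (m (\<Psi> z) * P1 z ^ 2 + of_real (\<mu> (\<Psi> z)) * P2 z) * cnj (P1 z)" for z
  define L where "L z = \<mu> (\<Psi> z) * Re (P1 z * cnj (P1 z))" for z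
  have "Im ((m2 (\<Psi> \<zeta>) * P1 \<zeta> ^ 3 + 3 * m (\<Psi> \<zeta>) * P1 \<zeta> * P2 \<zeta>
      + of_real (\<mu> (\<Psi> \<zeta>)) * P3 \<zeta>) * cnj (P1 \<zeta>)) = 0"
  proof (rule separated_Im_wirtinger[OF W, where L = L and l = l
        and \<beta> = "(m11 (\<Psi> \<zeta>) * cnj (P1 \<zeta>) * P1 \<zeta> ^ 2 + cnj (m (\<Psi> \<zeta>) * P1 \<zeta>) * P2 \<zeta>) * cnj (P1 \<zeta>)
          + (m (\<Psi> \<zeta>) * P1 \<zeta> ^ 2 + of_real (\<mu> (\<Psi> \<zeta>)) * P2 \<zeta>) * cnj (P2 \<zeta>)"])
    fix z assume z: "z \<in> W"
    have "Re (P1 z * cnj (P1 z)) = (cmod (P1 z))\<^sup>2"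
      unfolding cmod_power2 by (simp add: power2_eq_square)
    then show "L z = b1 (Re z) - b2 (Im z)"
      using sep[OF z] by (simp add: L_def P1_def)
    show "(L has_derivative (\<lambda>a. 2 * Re (l z * a))) (at z)"
      unfolding L_def l_def
      by (rule has_derivative_eq_rhs, rule has_derivative_mult[OF \<mu>der[OF z]
            has_derivative_Re[OF has_derivative_mult[OF der(2)[OF z] cder[OF z]]]])
        (auto simp: fun_eq_iff power2_eq_square algebra_simps)
  next
    show "(l has_derivative (\<lambda>a. (m2 (\<Psi> \<zeta>) * P1 \<zeta> ^ 3 + 3 * m (\<Psi> \<zeta>) * P1 \<zeta> * P2 \<zeta>
      + of_real (\<mu> (\<Psi> \<zeta>)) * P3 \<zeta>) * cnj (P1 \<zeta>) * a
      + ((m11 (\<Psi> \<zeta>) * cnj (P1 \<zeta>) * P1 \<zeta> ^ 2 + cnj (m (\<Psi> \<zeta>) * P1 \<zeta>) * P2 \<zeta>) * cnj (P1 \<zeta>)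
          + (m (\<Psi> \<zeta>) * P1 \<zeta> ^ 2 + of_real (\<mu> (\<Psi> \<zeta>)) * P2 \<zeta>) * cnj (P2 \<zeta>)) * cnj a)) (at \<zeta>)"
    proof -
      \<comment> \<open>The differential of the real function \<open>\<mu>\<close> enters as twice a
        real part; as w + cnj w it makes the goal a polynomial identity in the quantities and their
        conjugates.\<close>
      have re: "complex_of_real (2 * Re w) = w + cnj w" for w
        by (simp add: complex_eq_iff)
      show ?thesis
        unfolding l_def power2_eq_square
        by (rule has_derivative_eq_rhs, rule has_derivative_mult[OF has_derivative_add[OF
              has_derivative_mult[OF mder[OF W(2)] has_derivative_mult[OF der(2,2)[OF W(2)]]]
              has_derivative_mult[OF has_derivative_of_real[OF \<mu>der[OF W(2)]] der(3)[OF W(2)]]]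
              cder[OF W(2)]], rule ext, simp only: re complex_cnj_mult complex_cnj_add complex_cnj_cnj)
          algebra
    qed
  qed
  then show ?thesis by (simp add: P1_def P2_def P3_def)
qed

section \<open>The quotient that equals 1 / F'^2 in every Dini chart\<close>

text \<open>The cube root is \<open>\<beta>\<^sub>1 \<beta>\<^sub>2\<close> in any Dini chart; the numerator is \<open>- 2 cnj B\<close>.\<close>

definition dini_quot where
  "dini_quot \<mu> E F H p = Complex (H p - E p) (- 2 * F p) /
     of_real ((root 3 ((E p * H p - (F p)\<^sup>2) / (\<mu> p)\<^sup>2))\<^sup>2 * (\<mu> p)\<^sup>2)"
  for \<mu> E F H :: "complex \<Rightarrow> real"

text \<open>The determinant ratio is (b1 b2)^3, so the root is b1 b2. The trace-free part of the
  second form gives the numerator (b2 - b1)^2 cnj(\<open>\<omega>\<close>)^2. From b1 b2 mu = (b2 -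
  b1) |\<open>\<omega>\<close>|^2 the denominator is (b2 - b1)^2 |\<open>\<omega>\<close>|^4, and
  the factors of b2 - b1 cancel.\<close>

lemma dini_form_point:
  fixes mu e f h b1 b2 :: real and \<omega> :: complex
  assumes \<omega>: "\<omega> \<noteq> 0" and b: "b1 < b2" and mu: "mu > 0"
    and conf: "\<And>a. mu * ((Re a)\<^sup>2 + (Im a)\<^sup>2) = (1 / b1 - 1 / b2) * ((Re (\<omega> * a))\<^sup>2 + (Im (\<omega> * a))\<^sup>2)"
    and form: "\<And>a. e * (Re a)\<^sup>2 + 2 * f * Re a * Im a + h * (Im a)\<^sup>2 =
      b1 * b2 * (1 / b1 - 1 / b2) * (b1 * (Re (\<omega> * a))\<^sup>2 + b2 * (Im (\<omega> * a))\<^sup>2)"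
    and pos: "\<And>a. a \<noteq> 0 \<Longrightarrow> e * (Re a)\<^sup>2 + 2 * f * Re a * Im a + h * (Im a)\<^sup>2 > 0"
  shows "Complex (h - e) (- 2 * f) / of_real ((root 3 ((e * h - f\<^sup>2) / mu\<^sup>2))\<^sup>2 * mu\<^sup>2) = 1 / \<omega>\<^sup>2"
proof -
  define \<Lambda> where "\<Lambda> = 1 / b1 - 1 / b2"
  \<comment> \<open>Multiplication by \<open>\<omega>\<close> sends \<open>1 / \<omega>\<close> and
    \<open>\<i> / \<omega>\<close> to the two Dini coordinate vectors.\<close>
  have p1: "b1 * b2 * \<Lambda> * b1 > 0"
    using pos[of "1 / \<omega>"] \<omega> unfolding form \<Lambda>_def[symmetric] by simp
  have p2: "b1 * b2 * \<Lambda> * b2 > 0"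
    using pos[of "\<i> / \<omega>"] \<omega> unfolding form \<Lambda>_def[symmetric] by simp
  have "1 / \<omega> \<noteq> 0" using \<omega> by simp
  then have "(Re (1 / \<omega>))\<^sup>2 + (Im (1 / \<omega>))\<^sup>2 > 0"
    by (simp only: complex_neq_0)
  then have "mu * ((Re (1 / \<omega>))\<^sup>2 + (Im (1 / \<omega>))\<^sup>2) > 0"
    using mu by (rule mult_pos_pos[rotated])
  then have \<Lambda>: "\<Lambda> > 0"
    using \<omega> unfolding conf \<Lambda>_def[symmetric] by simp
  \<comment> \<open>This excludes the default value \<open>1 / 0 = 0\<close> in the Dini
    formulas.\<close>
  have nz: "b1 \<noteq> 0" "b2 \<noteq> 0" using p1 by auto
  \<comment> \<open>Positivity of the first metric forces \<open>b2 < 0\<close> whenever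
    \<open>b1 < 0\<close>; positivity of the second then rules out two negative values.\<close>
  have b1: "b1 > 0"
  proof (rule ccontr)
    assume "\<not> b1 > 0"
    then have "b1 < 0" using nz by simp
    have "b2 < 0"
    proof (rule ccontr)
      assume "\<not> b2 < 0"
      then have "1 / b1 < 0" "1 / b2 > 0" using nz \<open>b1 < 0\<close> by auto
      then show False using \<Lambda> unfolding \<Lambda>_def by linarith
    qed
    then have "b1 * b2 * \<Lambda> > 0" using \<open>b1 < 0\<close> \<Lambda> by (simp add: mult_neg_neg)
    from mult_pos_neg[OF this \<open>b1 < 0\<close>] show False using p1 by simp
  qed
  then have b2: "b2 > 0" using b by simp
  define c d where "c = Re \<omega>" and "d = Im \<omega>"
  have k: "b1 * b2 * \<Lambda> = b2 - b1" using nz by (simp add: \<Lambda>_def field_simps)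
  have E: "e = (b2 - b1) * (b1 * c\<^sup>2 + b2 * d\<^sup>2)"
    using form[of 1] unfolding \<Lambda>_def[symmetric] k by (simp add: c_def d_def)
  have H: "h = (b2 - b1) * (b1 * d\<^sup>2 + b2 * c\<^sup>2)"
    using form[of \<i>] unfolding \<Lambda>_def[symmetric] k by (simp add: c_def d_def)
  have F: "f = (b2 - b1)\<^sup>2 * c * d"
    using form[of "Complex 1 1"] unfolding \<Lambda>_def[symmetric] k E H
    by (simp add: c_def[symmetric] d_def[symmetric] power2_eq_square algebra_simps)
  have M: "mu = \<Lambda> * (c\<^sup>2 + d\<^sup>2)"
    using conf[of 1] unfolding \<Lambda>_def[symmetric] by (simp add: c_def d_def)
  have cd: "c\<^sup>2 + d\<^sup>2 > 0" using \<omega> complex_neq_0 c_def d_def by simp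
  have "e * h - f\<^sup>2 = (b2 - b1)\<^sup>2 * (b1 * b2 * (c\<^sup>2 + d\<^sup>2)\<^sup>2)"
    unfolding E H F by (simp add: power2_eq_square algebra_simps)
  also have "\<dots> = (b1 * b2) ^ 3 * mu\<^sup>2"
    unfolding k[symmetric] M by (simp add: power2_eq_square power3_eq_cube)
  finally have "(e * h - f\<^sup>2) / mu\<^sup>2 = (b1 * b2) ^ 3" using mu by simp
  then have root: "root 3 ((e * h - f\<^sup>2) / mu\<^sup>2) = b1 * b2"
    by (simp add: odd_real_root_power_cancel)
  have num: "Complex (h - e) (- 2 * f) = of_real ((b2 - b1)\<^sup>2) * (cnj \<omega>)\<^sup>2"
    unfolding E H F complex_eq_iff
    by (simp add: c_def d_def power2_eq_square algebra_simps)
  have den: "(b1 * b2)\<^sup>2 * mu\<^sup>2 = (b2 - b1)\<^sup>2 * (c\<^sup>2 + d\<^sup>2)\<^sup>2"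
    unfolding k[symmetric] M by (simp add: power2_eq_square)
  have cn: "of_real (c\<^sup>2 + d\<^sup>2) = \<omega> * cnj \<omega>"
    by (simp add: complex_mult_cnj c_def d_def)
  have "Complex (h - e) (- 2 * f) / of_real ((root 3 ((e * h - f\<^sup>2) / mu\<^sup>2))\<^sup>2 * mu\<^sup>2)
      = of_real ((b2 - b1)\<^sup>2) * (cnj \<omega>)\<^sup>2 / (of_real ((b2 - b1)\<^sup>2) * (of_real (c\<^sup>2 + d\<^sup>2))\<^sup>2)"
    unfolding root num den by simp
  also have "\<dots> = 1 / \<omega>\<^sup>2"
    unfolding cn using \<omega> b by (simp add: power_mult_distrib)
  finally show ?thesis .
qed

lemma coef_metric_diag:
  "coef_metric E F H p a a = E p * (Re a)\<^sup>2 + 2 * F p * Re a * Im a + H p * (Im a)\<^sup>2"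
  by (simp add: coef_metric_def power2_eq_square algebra_simps)

lemma dini_chart_quot:
  assumes chart: "dini_chart (coef_metric \<mu> (\<lambda>_. 0) \<mu>) (coef_metric E F H) P \<Phi>" and p: "p \<in> P"
    and \<mu>: "\<mu> p > 0" and pos: "\<And>a. a \<noteq> 0 \<Longrightarrow> coef_metric E F H p a a > 0"
  shows "dini_quot \<mu> E F H p = 1 / (deriv \<Phi> p)\<^sup>2"
proof -
  obtain \<beta>1 \<beta>2 where \<beta>: "\<beta>1 (Re (\<Phi> p)) < \<beta>2 (Im (\<Phi> p))"
    "\<And>a. coef_metric \<mu> (\<lambda>_. 0) \<mu> p a a = (1 / \<beta>1 (Re (\<Phi> p)) - 1 / \<beta>2 (Im (\<Phi> p))) *
        ((Re (deriv \<Phi> p * a))\<^sup>2 + (Im (deriv \<Phi> p * a))\<^sup>2)"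
    "\<And>a. coef_metric E F H p a a = \<beta>1 (Re (\<Phi> p)) * \<beta>2 (Im (\<Phi> p)) *
        (1 / \<beta>1 (Re (\<Phi> p)) - 1 / \<beta>2 (Im (\<Phi> p))) *
        (\<beta>1 (Re (\<Phi> p)) * (Re (deriv \<Phi> p * a))\<^sup>2 + \<beta>2 (Im (\<Phi> p)) * (Im (deriv \<Phi> p * a))\<^sup>2)"
    using chart p unfolding dini_chart_def Let_def by blast
  have "deriv \<Phi> p \<noteq> 0" using chart p by (auto simp: dini_chart_def)
  then show ?thesis
    unfolding dini_quot_def
  proof (rule dini_form_point[OF _ \<beta>(1) \<mu>])
    show "\<mu> p * ((Re a)\<^sup>2 + (Im a)\<^sup>2) = (1 / \<beta>1 (Re (\<Phi> p)) - 1 / \<beta>2 (Im (\<Phi> p))) *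
        ((Re (deriv \<Phi> p * a))\<^sup>2 + (Im (deriv \<Phi> p * a))\<^sup>2)" for a
      unfolding \<beta>(2)[of a, symmetric] coef_metric_diag by (simp add: algebra_simps)
  qed (use \<beta>(3) pos in \<open>simp_all add: coef_metric_diag\<close>)
qed

lemma coef_metric_det_pos:
  assumes "\<And>a. a \<noteq> 0 \<Longrightarrow> coef_metric E F H p a a > 0"
  shows "E p * H p - (F p)\<^sup>2 > 0"
proof -
  have E: "E p > 0" using assms[of 1] by (simp add: coef_metric_diag)
  \<comment> \<open>The test vector is orthogonal to 1 for the second metric.\<close>
  have "0 < coef_metric E F H p (Complex (- F p) (E p)) (Complex (- F p) (E p))"
    using E by (intro assms) (simp add: complex_eq_iff)
  also have "\<dots> = E p * (E p * H p - (F p)\<^sup>2)"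
    by (simp add: coef_metric_diag power2_eq_square algebra_simps)
  finally show ?thesis using E by (simp add: zero_less_mult_iff)
qed

text \<open>The formula refers to no chart, so continuity also covers the proportional point, where
  the singularity has to be removed. Positive determinants keep the cube root nonzero.\<close>

lemma continuous_on_dini_quot:
  assumes "continuous_on U \<mu>" "continuous_on U E" "continuous_on U F" "continuous_on U H"
    and "\<And>p. p \<in> U \<Longrightarrow> \<mu> p > 0"
    and "\<And>p a. p \<in> U \<Longrightarrow> a \<noteq> 0 \<Longrightarrow> coef_metric E F H p a a > 0"
  shows "continuous_on U (dini_quot \<mu> E F H)"
proof -
  have "E p * H p - (F p)\<^sup>2 \<noteq> 0" "\<mu> p \<noteq> 0" if "p \<in> U" for p
    using coef_metric_det_pos[of E F H p] assms(5,6)[OF that] by fastforce+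
  then show ?thesis
    unfolding dini_quot_def Complex_eq
    by (intro continuous_intros assms(1-4)) auto
qed

lemma proportional_imp_dini_quot_eq_0:
  assumes "proportional_at (coef_metric \<mu> (\<lambda>_. 0) \<mu>) (coef_metric E F H) p"
  shows "dini_quot \<mu> E F H p = 0"
proof -
  obtain c where c: "\<And>a b. coef_metric E F H p a b = c * coef_metric \<mu> (\<lambda>_. 0) \<mu> p a b"
    using assms by (auto simp: proportional_at_def)
  from c[of 1 1] c[of \<i> \<i>] c[of 1 \<i>] have "H p = E p" "F p = 0"
    by (simp_all add: coef_metric_def)
  then show ?thesis by (simp add: dini_quot_def complex_eq_iff)
qed

section \<open>The second-order equation for 1 / F'^2\<close>

text \<open>For the inverse \<open>\<Psi>\<close> of \<open>\<Phi>\<close>, Q along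
  \<open>\<Psi>\<close> is \<open>\<Psi>\<close>'^2. Differentiating and cancelling the nonzero
  \<open>\<Psi>\<close>' turns Q' into 2 \<open>\<Psi>\<close>'' and Q'' \<open>\<Psi>\<close>' into
  2 \<open>\<Psi>\<close>'''. With these, the expression in \<open>liouville_form_Im\<close> becomes
  the present one times the positive real |\<open>\<Psi>\<close>'|^2.\<close>

lemma dini_chart_liouville:
  fixes Q :: "complex \<Rightarrow> complex"
  assumes chart: "dini_chart (coef_metric \<mu> (\<lambda>_. 0) \<mu>) g2 P \<Phi>" and p: "p \<in> P" and PU: "P \<subseteq> U"
    and U: "open U" and hol: "Q holomorphic_on U"
    and Q: "\<And>p. p \<in> P \<Longrightarrow> Q p = 1 / (deriv \<Phi> p)\<^sup>2"
    and m: "\<And>p. p \<in> U \<Longrightarrow> (\<mu> has_derivative (\<lambda>a. 2 * Re (m p * a))) (at p)"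
    and m2: "\<And>p. p \<in> U \<Longrightarrow> (m has_derivative (\<lambda>a. m2 p * a + m11 p * cnj a)) (at p)"
  shows "Im (m2 p * Q p + 3 / 2 * m p * deriv Q p + of_real (\<mu> p) * deriv (deriv Q) p / 2) = 0"
proof -
  have oP: "open P" and \<Phi>: "\<Phi> holomorphic_on P" "inj_on \<Phi> P"
    and nz: "\<And>p. p \<in> P \<Longrightarrow> deriv \<Phi> p \<noteq> 0"
    using chart by (auto simp: dini_chart_def)
  obtain \<beta>1 \<beta>2 where \<beta>: "\<And>p a. p \<in> P \<Longrightarrow>
      coef_metric \<mu> (\<lambda>_. 0) \<mu> p a a = (1 / \<beta>1 (Re (\<Phi> p)) - 1 / \<beta>2 (Im (\<Phi> p))) *
        ((Re (deriv \<Phi> p * a))\<^sup>2 + (Im (deriv \<Phi> p * a))\<^sup>2)"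
    using chart unfolding dini_chart_def Let_def by blast
  define W where "W = \<Phi> ` P"
  have W: "open W" unfolding W_def using open_mapping_thm3[OF \<Phi>(1) oP \<Phi>(2)] .
  obtain \<Psi> where \<Psi>: "\<Psi> holomorphic_on W"
      "\<And>z. z \<in> P \<Longrightarrow> deriv \<Phi> z * deriv \<Psi> (\<Phi> z) = 1" "\<And>z. z \<in> P \<Longrightarrow> \<Psi> (\<Phi> z) = z"
    using holomorphic_has_inverse[OF \<Phi>(1) oP \<Phi>(2)] unfolding W_def by blast
  have \<Psi>P: "\<Psi> ` W \<subseteq> P" using \<Psi>(3) by (auto simp: W_def)
  have d0: "deriv \<Psi> (\<Phi> z) = 1 / deriv \<Phi> z" if "z \<in> P" for z
    using \<Psi>(2)[OF that] nz[OF that] by (simp add: field_simps)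
  have dnz: "deriv \<Psi> \<zeta> \<noteq> 0" if "\<zeta> \<in> W" for \<zeta>
    using that d0 nz by (auto simp: W_def)
  define P1 where "P1 = deriv \<Psi>"
  define P2 where "P2 = deriv P1"
  have h1: "P1 holomorphic_on W" and h2: "P2 holomorphic_on W"
    unfolding P1_def P2_def using \<Psi>(1) W by (auto intro!: holomorphic_deriv)
  have hQ': "deriv Q holomorphic_on U" using hol U by (rule holomorphic_deriv)
  have d\<Psi>: "(\<Psi> has_field_derivative P1 \<zeta>) (at \<zeta>)" if "\<zeta> \<in> W" for \<zeta>
    unfolding P1_def using holomorphic_derivI[OF \<Psi>(1) W that] .
  have dP1: "(P1 has_field_derivative P2 \<zeta>) (at \<zeta>)" if "\<zeta> \<in> W" for \<zeta>
    unfolding P2_def using holomorphic_derivI[OF h1 W that] .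
  have inU: "\<Psi> \<zeta> \<in> U" if "\<zeta> \<in> W" for \<zeta> using that \<Psi>P PU by blast
  have Q0: "Q (\<Psi> \<zeta>) = (P1 \<zeta>)\<^sup>2" if "\<zeta> \<in> W" for \<zeta>
    using that Q d0 \<Psi>(3) by (auto simp: W_def P1_def power_divide)
  have Q1: "deriv Q (\<Psi> \<zeta>) = 2 * P2 \<zeta>" if \<zeta>: "\<zeta> \<in> W" for \<zeta>
  proof -
    have "((\<lambda>\<zeta>. Q (\<Psi> \<zeta>)) has_field_derivative deriv Q (\<Psi> \<zeta>) * P1 \<zeta>) (at \<zeta>)"
      by (rule DERIV_chain2[OF holomorphic_derivI[OF hol U inU[OF \<zeta>]] d\<Psi>[OF \<zeta>]])
    moreover have "((\<lambda>\<zeta>. (P1 \<zeta>)\<^sup>2) has_field_derivative 2 * P1 \<zeta> * P2 \<zeta>) (at \<zeta>)"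
      by (auto intro!: derivative_eq_intros dP1[OF \<zeta>])
    then have "((\<lambda>\<zeta>. Q (\<Psi> \<zeta>)) has_field_derivative 2 * P1 \<zeta> * P2 \<zeta>) (at \<zeta>)"
      by (rule has_field_derivative_transform_within_open[OF _ W \<zeta>]) (simp add: Q0)
    ultimately show ?thesis using DERIV_unique dnz[OF \<zeta>] unfolding P1_def by fastforce
  qed
  have Q2: "deriv (deriv Q) (\<Psi> \<zeta>) * P1 \<zeta> = 2 * deriv P2 \<zeta>" if \<zeta>: "\<zeta> \<in> W" for \<zeta>
  proof -
    have "((\<lambda>\<zeta>. deriv Q (\<Psi> \<zeta>)) has_field_derivative deriv (deriv Q) (\<Psi> \<zeta>) * P1 \<zeta>) (at \<zeta>)"
      by (rule DERIV_chain2[OF holomorphic_derivI[OF hQ' U inU[OF \<zeta>]] d\<Psi>[OF \<zeta>]])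
    moreover have "((\<lambda>\<zeta>. 2 * P2 \<zeta>) has_field_derivative 2 * deriv P2 \<zeta>) (at \<zeta>)"
      by (intro DERIV_cmult holomorphic_derivI[OF h2 W \<zeta>])
    then have "((\<lambda>\<zeta>. deriv Q (\<Psi> \<zeta>)) has_field_derivative 2 * deriv P2 \<zeta>) (at \<zeta>)"
      by (rule has_field_derivative_transform_within_open[OF _ W \<zeta>]) (simp add: Q1)
    ultimately show ?thesis by (rule DERIV_unique)
  qed
  define \<zeta> where "\<zeta> = \<Phi> p"
  have \<zeta>: "\<zeta> \<in> W" and \<Psi>\<zeta>: "\<Psi> \<zeta> = p" using p \<Psi>(3) by (auto simp: \<zeta>_def W_def)
  have "Im ((m2 (\<Psi> \<zeta>) * deriv \<Psi> \<zeta> ^ 3 + 3 * m (\<Psi> \<zeta>) * deriv \<Psi> \<zeta> * deriv (deriv \<Psi>) \<zeta>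
      + of_real (\<mu> (\<Psi> \<zeta>)) * deriv (deriv (deriv \<Psi>)) \<zeta>) * cnj (deriv \<Psi> \<zeta>)) = 0"
  proof (rule liouville_form_Im[OF W \<zeta> \<Psi>(1) _ _ m m2])
    show "\<Psi> ` W \<subseteq> U" using inU by blast
    fix \<xi> assume "\<xi> \<in> W"
    then obtain q where q: "q \<in> P" "\<xi> = \<Phi> q" by (auto simp: W_def)
    have "\<mu> q * (cmod (deriv \<Psi> \<xi>))\<^sup>2 = coef_metric \<mu> (\<lambda>_. 0) \<mu> q (deriv \<Psi> \<xi>) (deriv \<Psi> \<xi>)"
      unfolding cmod_power2 coef_metric_diag by (simp add: algebra_simps)
    also have "\<dots> = 1 / \<beta>1 (Re \<xi>) - 1 / \<beta>2 (Im \<xi>)"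
      unfolding \<beta>[OF q(1)] q(2) \<Psi>(2)[OF q(1)] by simp
    finally show "\<mu> (\<Psi> \<xi>) * (cmod (deriv \<Psi> \<xi>))\<^sup>2 = 1 / \<beta>1 (Re \<xi>) - 1 / \<beta>2 (Im \<xi>)"
      using q \<Psi>(3) by simp
  qed
  also have "(m2 (\<Psi> \<zeta>) * deriv \<Psi> \<zeta> ^ 3 + 3 * m (\<Psi> \<zeta>) * deriv \<Psi> \<zeta> * deriv (deriv \<Psi>) \<zeta>
      + of_real (\<mu> (\<Psi> \<zeta>)) * deriv (deriv (deriv \<Psi>)) \<zeta>) * cnj (deriv \<Psi> \<zeta>)
    = (m2 p * P1 \<zeta> ^ 3 + 3 * m p * P1 \<zeta> * P2 \<zeta> + of_real (\<mu> p) * deriv P2 \<zeta>) * cnj (P1 \<zeta>)"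
    by (simp add: \<Psi>\<zeta> P1_def P2_def)
  also have "\<dots> = (m2 p * Q p + 3 / 2 * m p * deriv Q p + of_real (\<mu> p) * deriv (deriv Q) p / 2)
      * (P1 \<zeta> * cnj (P1 \<zeta>))"
  proof -
    have e: "Q p = (P1 \<zeta>)\<^sup>2" "deriv Q p = 2 * P2 \<zeta>" "deriv P2 \<zeta> = deriv (deriv Q) p * P1 \<zeta> / 2"
      using Q0[OF \<zeta>] Q1[OF \<zeta>] Q2[OF \<zeta>] \<Psi>\<zeta> by auto
    show ?thesis unfolding e by (simp add: power2_eq_square power3_eq_cube algebra_simps)
  qed
  also have "P1 \<zeta> * cnj (P1 \<zeta>) = of_real ((cmod (P1 \<zeta>))\<^sup>2)"
    by (metis complex_norm_square)
  finally show ?thesis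
    using dnz[OF \<zeta>] unfolding P1_def by simp
qed

section \<open>The order of the zero of Q\<close>

text \<open>Writing the exponent as \<open>Suc j\<close> avoids truncated subtraction. The new
  cofactor is again holomorphic, so the rule can be iterated to reach the second derivative.\<close>

lemma deriv_power_factor:
  assumes S: "open S" "w \<in> S" and G: "G holomorphic_on S"
    and F: "\<And>w. w \<in> S \<Longrightarrow> F w = (w - z0) ^ Suc j * G w"
  shows "deriv F w = (w - z0) ^ j * (of_nat (Suc j) * G w + (w - z0) * deriv G w)"
proof -
  have "((\<lambda>w. (w - z0) ^ Suc j * G w) has_field_derivative
      (w - z0) ^ j * (of_nat (Suc j) * G w + (w - z0) * deriv G w)) (at w)"
    by (rule DERIV_cong[OF DERIV_mult[OF DERIV_power_Suc[where D = 1] holomorphic_derivI[OF G S]]])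
      (auto intro!: derivative_eq_intros simp: algebra_simps)
  then have "(F has_field_derivative
      (w - z0) ^ j * (of_nat (Suc j) * G w + (w - z0) * deriv G w)) (at w)"
    by (rule has_field_derivative_transform_within_open[OF _ S]) (simp add: F)
  then show ?thesis by (rule DERIV_imp_deriv)
qed

lemma Im_of_real_mult: "Im (of_real c * z) = c * Im z"
  by simp

text \<open>The coefficients \<open>\<mu>\<close>, \<open>m\<close>, \<open>m2\<close> are only
  continuous, so power series cannot be compared in the equation. Instead its leading term at
  \<open>z0\<close> is isolated and tested along rays.\<close>

lemma liouville_zero_order:
  fixes \<mu> :: "complex \<Rightarrow> real" and Q m m2 :: "complex \<Rightarrow> complex"
  assumes r: "r > 0" and Q: "Q holomorphic_on ball z0 r" "Q z0 = 0"
      "\<And>z. z \<in> ball z0 r - {z0} \<Longrightarrow> Q z \<noteq> 0"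
    and cont: "continuous_on (ball z0 r) \<mu>" "continuous_on (ball z0 r) m"
      "continuous_on (ball z0 r) m2"
    and \<mu>: "\<mu> z0 > 0"
    and Im0: "\<And>p. p \<in> ball z0 r - {z0} \<Longrightarrow>
      Im (m2 p * Q p + 3 / 2 * m p * deriv Q p + of_real (\<mu> p) * deriv (deriv Q) p / 2) = 0"
  obtains n g \<rho> where "0 < \<rho>" "\<rho> \<le> r" "n = 1 \<or> n = 2" "g holomorphic_on ball z0 \<rho>"
    "\<And>w. w \<in> ball z0 \<rho> \<Longrightarrow> Q w = (w - z0) ^ n * g w" "\<And>w. w \<in> ball z0 \<rho> \<Longrightarrow> g w \<noteq> 0"
    "n = 2 \<Longrightarrow> g z0 \<in> \<real>"
proof -
  have nconst: "\<not> Q constant_on ball z0 r"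
  proof
    assume "Q constant_on ball z0 r"
    moreover have "z0 \<in> ball z0 r" "z0 + of_real (r / 2) \<in> ball z0 r - {z0}"
      using r by (auto simp: dist_norm)
    ultimately show False using Q(2,3) unfolding constant_on_def by (metis DiffD1)
  qed
  obtain g \<rho> n where g: "0 < n" "0 < \<rho>" "ball z0 \<rho> \<subseteq> ball z0 r" "g holomorphic_on ball z0 \<rho>"
    "\<And>w. w \<in> ball z0 \<rho> \<Longrightarrow> Q w = (w - z0) ^ n * g w" "\<And>w. w \<in> ball z0 \<rho> \<Longrightarrow> g w \<noteq> 0"
    by (rule holomorphic_factor_zero_nonconstant[OF Q(1) open_ball connected_ball _ Q(2) nconst])
      (use r in simp, rule that)
  have \<rho>r: "\<rho> \<le> r" using g(2,3) by (simp add: ball_subset_ball_iff)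
  let ?B = "ball z0 \<rho>"
  have z0: "z0 \<in> ?B" using g(2) by simp
  have key: "n = 2 \<and> g z0 \<in> \<real>" if "n \<noteq> 1"
  proof -
    \<comment> \<open>No truncation occurs: \<open>n\<close> is positive and different from 1 in
      this branch.\<close>
    define k where "k = n - 2"
    have k: "n = Suc (Suc k)" using g(1) that by (simp add: k_def)
    define g1 where "g1 w = of_nat (Suc (Suc k)) * g w + (w - z0) * deriv g w" for w
    define g2 where "g2 w = of_nat (Suc k) * g1 w + (w - z0) * deriv g1 w" for w
    have hg1: "g1 holomorphic_on ?B"
      unfolding g1_def by (intro holomorphic_intros holomorphic_deriv g(4)) auto
    have hg2: "g2 holomorphic_on ?B"
      unfolding g2_def by (intro holomorphic_intros holomorphic_deriv hg1) auto
    have Q1: "deriv Q w = (w - z0) ^ Suc k * g1 w" if "w \<in> ?B" for w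
      unfolding g1_def using that g(4) by (rule deriv_power_factor[OF open_ball]) (simp add: g(5) k)
    have Q2: "deriv (deriv Q) w = (w - z0) ^ k * g2 w" if "w \<in> ?B" for w
      unfolding g2_def using that hg1 by (rule deriv_power_factor[OF open_ball]) (simp add: Q1)
    \<comment> \<open>The differential expression divided by (w - z0)^k. The terms with
      \<open>m2\<close> and \<open>m\<close> keep a factor vanishing at \<open>z0\<close>, so only
      the one with Q'' contributes there.\<close>
    define R where "R w = m2 w * (w - z0)\<^sup>2 * g w + 3 / 2 * m w * (w - z0) * g1 w
        + of_real (\<mu> w) * g2 w / 2" for w
    have "continuous_on ?B R"
      unfolding R_def
      by (intro continuous_intros continuous_on_subset[OF cont(1) g(3)]
          continuous_on_subset[OF cont(2) g(3)] continuous_on_subset[OF cont(3) g(3)]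
          holomorphic_on_imp_continuous_on g(4) hg1 hg2) auto
    then have Rcont: "isCont R z0"
      using z0 by (simp add: continuous_on_eq_continuous_at)
    have factor: "m2 w * Q w + 3 / 2 * m w * deriv Q w + of_real (\<mu> w) * deriv (deriv Q) w / 2
        = (w - z0) ^ k * R w" if "w \<in> ?B" for w
      unfolding g(5)[OF that] Q1[OF that] Q2[OF that] R_def
      by (simp add: k power2_eq_square field_simps)
    \<comment> \<open>Approach \<open>z0\<close> along the ray in direction \<open>u\<close>.\<close>
    have ray: "Im (u ^ k * R z0) = 0" if u: "cmod u = 1" for u
    proof -
      have "((\<lambda>t. z0 + of_real t * u) \<longlongrightarrow> z0 + of_real 0 * u) (at_right 0)"
        by (intro tendsto_intros)
      then have "((\<lambda>t. R (z0 + of_real t * u)) \<longlongrightarrow> R z0) (at_right 0)"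
        using isCont_tendsto_compose[OF Rcont] by simp
      then have "((\<lambda>t. Im (u ^ k * R (z0 + of_real t * u))) \<longlongrightarrow> Im (u ^ k * R z0)) (at_right 0)"
        by (intro tendsto_intros)
      moreover have "\<forall>\<^sub>F t in at_right 0. Im (u ^ k * R (z0 + of_real t * u)) = 0"
        using eventually_at_right_less[of 0] eventually_at_right_real[OF g(2)]
      proof eventually_elim
        case (elim t)
        let ?w = "z0 + of_real t * u"
        have w: "?w \<in> ?B" "?w \<noteq> z0"
          using elim u by (auto simp: dist_norm norm_mult)
        then have "?w \<in> ball z0 r - {z0}" using g(3) by blast
        from Im0[OF this] have "Im ((of_real t * u) ^ k * R ?w) = 0"
          unfolding factor[OF w(1)] by (simp only: add_diff_cancel_left')
        also have "(of_real t * u) ^ k * R ?w = of_real (t ^ k) * (u ^ k * R ?w)"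
          by (simp add: power_mult_distrib)
        finally show ?case using elim by (simp only: Im_of_real_mult) simp
      qed
      then have "((\<lambda>t. Im (u ^ k * R (z0 + of_real t * u))) \<longlongrightarrow> 0) (at_right 0)"
        by (rule tendsto_eventually)
      ultimately show ?thesis
        using tendsto_unique trivial_limit_at_right_real by blast
    qed
    \<comment> \<open>Two differentiations of (w - z0)^n contribute the factor n (n - 1).\<close>
    have R0: "R z0 = of_real (\<mu> z0 * of_nat (Suc k) * of_nat (Suc (Suc k)) / 2) * g z0"
      by (simp add: R_def g1_def g2_def)
    have cpos: "\<mu> z0 * of_nat (Suc k) * of_nat (Suc (Suc k)) / 2 \<noteq> 0"
      using \<mu> by (simp del: of_nat_Suc)
    have Rnz: "R z0 \<noteq> 0"
      unfolding R0 using cpos g(6)[OF z0] by (simp del: of_nat_Suc)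
    have ImR: "Im (R z0) = 0" using ray[of 1] by simp
    \<comment> \<open>For positive \<open>k\<close> some unit direction has k-th power
      \<open>\<i>\<close>, which makes the real part of \<open>R z0\<close> vanish as well as the
      imaginary part.\<close>
    have "k = 0"
    proof (rule ccontr)
      assume "k \<noteq> 0"
      then have "real k * (pi / (2 * real k)) = pi / 2" by simp
      then have "cis (pi / (2 * of_nat k)) ^ k = \<i>"
        by (simp only: Complex.DeMoivre cis_pi_half)
      with ray[of "cis (pi / (2 * of_nat k))"] have "Re (R z0) = 0" by simp
      with ImR Rnz show False by (simp add: complex_eq_iff)
    qed
    moreover have "Im (g z0) = 0"
      using ImR cpos unfolding R0 by (simp only: Im_of_real_mult) simp
    ultimately show ?thesis by (simp add: k complex_is_Real_iff)
  qed
  show thesis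
    by (rule that[OF g(2) \<rho>r _ g(4,5,6)]) (use key in auto)
qed

section \<open>The pole of the reciprocal\<close>

text \<open>Near \<open>z0\<close>, \<open>h\<close> is the holomorphic nonvanishing 1 / g times (w
  - z0)^(-n). Its Laurent series is thus the Taylor series of 1 / g shifted by \<open>n\<close>,
  with lowest coefficient 1 / g(z0).\<close>

lemma inverse_zero_pole:
  assumes \<rho>: "0 < \<rho>" and g: "g holomorphic_on ball z0 \<rho>" "\<And>w. w \<in> ball z0 \<rho> \<Longrightarrow> g w \<noteq> 0"
    and n: "n > 0" and h: "\<And>w. w \<in> ball z0 \<rho> - {z0} \<Longrightarrow> h w = 1 / ((w - z0) ^ n * g w)"
  shows "is_pole h z0" "zorder h z0 = - int n"
    "fls_nth (laurent_expansion h z0) (- int n) = 1 / g z0"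
proof -
  define G where "G w = 1 / g w" for w
  have G: "G holomorphic_on ball z0 \<rho>"
    unfolding G_def using g by (intro holomorphic_intros) auto
  have Gz: "G z0 \<noteq> 0" using g(2)[of z0] \<rho> by (simp add: G_def)
  have hG: "h w = G w * (w - z0) powi (- int n)" if "w \<in> ball z0 \<rho>" "w \<noteq> z0" for w
    using h[of w] that by (simp add: G_def power_int_minus field_simps)
  show z: "zorder h z0 = - int n"
    by (rule zorder_eqI[OF open_ball _ G Gz hG]) (use \<rho> in auto)
  have "G analytic_on {z0}"
    using G \<rho> analytic_at by (metis centre_in_ball open_ball)
  then have "(\<lambda>x. G (z0 + x)) has_laurent_expansion fps_to_fls (fps_expansion G z0)"
    by (intro has_laurent_expansion_fps analytic_at_imp_has_fps_expansion)
  then have L: "(\<lambda>x. G (z0 + x) * x powi (- int n)) has_laurent_expansion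
      fls_shift (int n) (fps_to_fls (fps_expansion G z0))"
    by (rule has_laurent_expansion_shift')
  have "\<forall>\<^sub>F x in at 0. h (z0 + x) = G (z0 + x) * x powi (- int n)"
    using eventually_at_in_open[of "ball 0 \<rho>" 0] \<rho>
    by (auto elim!: eventually_mono simp: hG dist_norm)
  then have L': "(\<lambda>x. h (z0 + x)) has_laurent_expansion
      fls_shift (int n) (fps_to_fls (fps_expansion G z0))"
    using L by (subst has_laurent_expansion_cong[OF _ refl])
  show "fls_nth (laurent_expansion h z0) (- int n) = 1 / g z0"
    unfolding laurent_expansion_eqI[OF L'] by (simp add: fps_expansion_def G_def)
  have "((\<lambda>w. (w - z0) ^ n * g w) \<longlongrightarrow> (z0 - z0) ^ n * g z0) (at z0)"
  proof (intro tendsto_intros)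
    show "(g \<longlongrightarrow> g z0) (at z0)"
      using holomorphic_on_imp_continuous_on[OF g(1)] \<rho>
      by (metis centre_in_ball continuous_on_def at_within_open open_ball)
  qed
  then have lim: "((\<lambda>w. (w - z0) ^ n * g w) \<longlongrightarrow> 0) (at z0)"
    using n by (simp add: power_0_left)
  have ev: "\<forall>\<^sub>F w in at z0. w \<in> ball z0 \<rho> - {z0}"
    using \<rho> by (intro eventually_at_in_open) auto
  have "filterlim (\<lambda>w. inverse ((w - z0) ^ n * g w)) at_infinity (at z0)"
  proof (rule filterlim_compose[OF filterlim_inverse_at_infinity])
    have "\<forall>\<^sub>F w in at z0. (w - z0) ^ n * g w \<noteq> 0"
      using ev by eventually_elim (use g(2) in auto)
    then show "filterlim (\<lambda>w. (w - z0) ^ n * g w) (at 0) (at z0)"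
      using lim by (simp add: filterlim_at)
  qed
  moreover have "\<forall>\<^sub>F w in at z0. h w = inverse ((w - z0) ^ n * g w)"
    using ev by eventually_elim (simp add: h divide_inverse)
  ultimately show "is_pole h z0"
    unfolding is_pole_def by (subst filterlim_cong) auto
qed

section \<open>Passage from the charts to the punctured disc\<close>

theorem theorem5:
  fixes z0 :: complex and r :: real and \<mu> E F H :: "complex \<Rightarrow> real"
    and f :: "complex \<Rightarrow> complex"
  assumes "r > 0"
    and "smooth_fun (ball z0 r) \<mu>" and "\<forall>p\<in>ball z0 r. \<mu> p > 0"
    and "riemannian_metric (ball z0 r) E F H"
    and "geod_equiv (coef_metric \<mu> (\<lambda>_. 0) \<mu>) (coef_metric E F H) (ball z0 r)"
    and "proportional_at (coef_metric \<mu> (\<lambda>_. 0) \<mu>) (coef_metric E F H) z0"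
    and "\<exists>\<epsilon>>0. \<forall>p\<in>ball z0 \<epsilon> - {z0}.
           \<not> proportional_at (coef_metric \<mu> (\<lambda>_. 0) \<mu>) (coef_metric E F H) p"
    and "dini_transition_function (coef_metric \<mu> (\<lambda>_. 0) \<mu>) (coef_metric E F H) z0 r f"
  shows "\<exists>\<epsilon>>0. \<epsilon> \<le> r \<and> (\<exists>h. h holomorphic_on (ball z0 \<epsilon> - {z0}) \<and>
           (\<forall>w. Re w < ln \<epsilon> \<longrightarrow>
              h (z0 + exp w) = (deriv (elem f z0 (ball w 1)) (z0 + exp w))\<^sup>2) \<and>
           is_pole h z0 \<and> (zorder h z0 = -1 \<or> zorder h z0 = -2) \<and>
           (zorder h z0 = -2 \<longrightarrow> fls_nth (laurent_expansion h z0) (-2) \<in> \<real>))"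
proof -
  let ?g1 = "coef_metric \<mu> (\<lambda>_. 0) \<mu>" and ?g2 = "coef_metric E F H" and ?B = "ball z0 r"
  let ?\<pi> = "\<lambda>w. z0 + exp w"
  have r: "r > 0" by fact
  have pos: "coef_metric E F H p a a > 0" if "p \<in> ?B" "a \<noteq> 0" for p a
    using assms(4) that by (auto simp: riemannian_metric_def)
  have \<mu>: "\<mu> p > 0" if "p \<in> ?B" for p using assms(3) that by blast
  have sm: "continuous_on ?B f" if "smooth_fun ?B f" for f
  proof -
    have "Ck_on 0 ?B f" using that by (simp only: smooth_fun_def)
    then show ?thesis by simp
  qed
  have c\<mu>: "continuous_on ?B \<mu>" using assms(2) by (rule sm)
  define Q where "Q = dini_quot \<mu> E F H"
  have contQ: "continuous_on ?B Q"
    unfolding Q_def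
    by (rule continuous_on_dini_quot[OF c\<mu>])
      (use assms(4) \<mu> pos in \<open>auto simp: riemannian_metric_def intro: sm\<close>)
  have Q0: "Q z0 = 0"
    unfolding Q_def using assms(6) by (rule proportional_imp_dini_quot_eq_0)

  have expin: "?\<pi> w \<in> ?B - {z0}" if "Re w < ln r" for w
  proof -
    have "exp (Re w) < r" using that r by (metis exp_less_mono exp_ln)
    then show ?thesis by (simp add: dist_norm)
  qed
  have chart: "\<exists>V. open V \<and> w \<in> V \<and> inj_on ?\<pi> V \<and> ?\<pi> ` V \<subseteq> ?B - {z0} \<and>
      dini_chart ?g1 ?g2 (?\<pi> ` V) (elem f z0 V)" if w: "Re w < ln r" for w
  proof -
    obtain V where V: "open V" "w \<in> V" "V \<subseteq> {w. Re w < ln r}" "inj_on ?\<pi> V"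
        "dini_chart ?g1 ?g2 (?\<pi> ` V) (elem f z0 V)"
      using assms(8)[unfolded dini_transition_function_def, THEN conjunct2, rule_format, OF w]
      by (elim exE conjE)
    have "?\<pi> ` V \<subseteq> ?B - {z0}" using V(3) expin by auto
    with V show ?thesis by blast
  qed
  have local: "\<exists>P \<Phi>. p \<in> P \<and> P \<subseteq> ?B - {z0} \<and> dini_chart ?g1 ?g2 P \<Phi>"
    if p: "p \<in> ?B - {z0}" for p
  proof -
    \<comment> \<open>The principal logarithm picks one lift of \<open>p\<close>; only the existence
      of a chart around \<open>p\<close> matters.\<close>
    define w where "w = Ln (p - z0)"
    have "?\<pi> w = p" using p by (simp add: w_def)
    moreover have "Re w < ln r"
      using p r by (simp add: w_def dist_norm norm_minus_commute)
    ultimately show ?thesis using chart[of w] by (metis imageI)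
  qed
  have Qchart: "Q p = 1 / (deriv \<Phi> p)\<^sup>2" "deriv \<Phi> p \<noteq> 0"
    if "dini_chart ?g1 ?g2 P \<Phi>" "P \<subseteq> ?B - {z0}" "p \<in> P" for P \<Phi> p
  proof -
    have "p \<in> ?B" using that(2,3) by blast
    then show "Q p = 1 / (deriv \<Phi> p)\<^sup>2"
      unfolding Q_def by (intro dini_chart_quot[OF that(1,3) \<mu> pos])
    show "deriv \<Phi> p \<noteq> 0" using that(1,3) by (auto simp: dini_chart_def)
  qed
  have Qnz: "Q p \<noteq> 0" if p: "p \<in> ?B - {z0}" for p
    using local[OF p] Qchart by fastforce
  have "Q field_differentiable (at p)" if p: "p \<in> ?B - {z0}" for p
  proof -
    obtain P \<Phi> where P: "p \<in> P" "P \<subseteq> ?B - {z0}" "dini_chart ?g1 ?g2 P \<Phi>"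
      using local[OF p] by blast
    then have "open P" "\<Phi> holomorphic_on P" by (auto simp: dini_chart_def)
    then have "(\<lambda>p. 1 / (deriv \<Phi> p)\<^sup>2) holomorphic_on P"
      using Qchart(2)[OF P(3,2)] by (intro holomorphic_intros holomorphic_deriv) auto
    then have "Q holomorphic_on P"
      by (rule holomorphic_transform) (simp add: Qchart(1)[OF P(3,2)])
    then show ?thesis using \<open>open P\<close> P(1) holomorphic_on_imp_differentiable_at by blast
  qed
  then have "Q holomorphic_on ?B - {z0}"
    by (auto simp: holomorphic_on_def intro: field_differentiable_at_within)
  \<comment> \<open>Continuity of \<open>Q\<close> at \<open>z0\<close> makes the singularity
    removable.\<close>
  then have holQ: "Q holomorphic_on ?B"
    by (intro no_isolated_singularity[OF contQ, of "{z0}"]) auto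

  have "Ck_on 2 ?B \<mu>" using assms(2) by (simp only: smooth_fun_def)
  then obtain m m2 m11 where m: "\<And>p. p \<in> ?B \<Longrightarrow> (\<mu> has_derivative (\<lambda>a. 2 * Re (m p * a))) (at p)"
    "\<And>p. p \<in> ?B \<Longrightarrow> (m has_derivative (\<lambda>a. m2 p * a + m11 p * cnj a)) (at p)"
    "continuous_on ?B m2"
    using Ck_on_2_wirtinger by blast
  have cm: "continuous_on ?B m"
    using m(2) has_derivative_continuous continuous_at_imp_continuous_on by blast
  have Im0: "Im (m2 p * Q p + 3 / 2 * m p * deriv Q p + of_real (\<mu> p) * deriv (deriv Q) p / 2) = 0"
    if p: "p \<in> ?B - {z0}" for p
  proof -
    obtain P \<Phi> where P: "p \<in> P" "P \<subseteq> ?B - {z0}" "dini_chart ?g1 ?g2 P \<Phi>"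
      using local[OF p] by blast
    then have "P \<subseteq> ?B" by blast
    then show ?thesis
      by (rule dini_chart_liouville[OF P(3,1) _ open_ball holQ Qchart(1)[OF P(3,2)] m(1,2)])
  qed
  have \<mu>0: "\<mu> z0 > 0" using \<mu> r by simp
  obtain n g \<rho> where g: "0 < \<rho>" "\<rho> \<le> r" "n = 1 \<or> n = 2" "g holomorphic_on ball z0 \<rho>"
    "\<And>w. w \<in> ball z0 \<rho> \<Longrightarrow> Q w = (w - z0) ^ n * g w" "\<And>w. w \<in> ball z0 \<rho> \<Longrightarrow> g w \<noteq> 0"
    "n = 2 \<Longrightarrow> g z0 \<in> \<real>"
    by (rule liouville_zero_order[OF r holQ Q0 Qnz c\<mu> cm m(3) \<mu>0 Im0]) (assumption+, rule that)

  \<comment> \<open>By the division convention \<open>h z0 = 0\<close>, which affects neither the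
    pole nor the Laurent expansion.\<close>
  define h where "h p = 1 / Q p" for p
  have "h w = 1 / ((w - z0) ^ n * g w)" if "w \<in> ball z0 \<rho> - {z0}" for w
    using that g(5) by (simp add: h_def)
  moreover have "n > 0" using g(3) by auto
  ultimately have pole: "is_pole h z0" "zorder h z0 = - int n"
      "fls_nth (laurent_expansion h z0) (- int n) = 1 / g z0"
    using inverse_zero_pole[OF g(1,4,6)] by blast+
  have hol_h: "h holomorphic_on ?B - {z0}"
    unfolding h_def using Qnz by (intro holomorphic_intros holomorphic_on_subset[OF holQ]) auto
  \<comment> \<open>Single-valuedness: the square of the derivative at every lift is the value of
    the one function \<open>h\<close> at the base point. The sheet \<open>ball w 1\<close> is
    exchanged for a chart sheet \<open>V\<close> by \<open>elem_deriv\<close>.\<close>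
  have h_elem: "h (?\<pi> w) = (deriv (elem f z0 (ball w 1)) (?\<pi> w))\<^sup>2" if w: "Re w < ln r" for w
  proof -
    obtain V where V: "open V" "w \<in> V" "inj_on ?\<pi> V" "?\<pi> ` V \<subseteq> ?B - {z0}"
        "dini_chart ?g1 ?g2 (?\<pi> ` V) (elem f z0 V)"
      using chart[OF w] by blast
    have f: "f field_differentiable (at w)"
    proof (rule holomorphic_on_imp_differentiable_at)
      show "f holomorphic_on {w. Re w < ln r}"
        using assms(8) by (simp add: dini_transition_function_def)
    qed (use w in \<open>auto simp: open_halfspace_Re_lt\<close>)
    \<comment> \<open>Radius 1 lies below pi, so \<open>exp\<close> is injective on the ball. The
      ball may leave the half-plane where \<open>f\<close> is holomorphic, but only
      differentiability at \<open>w\<close> is required.\<close>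
    have inj: "inj_on ?\<pi> (ball w 1)"
    proof -
      have "ball w 1 \<subseteq> ball w pi" using pi_gt3 by (intro subset_ball) simp
      then show ?thesis using inj_on_subset[OF inj_on_exp_pi] by (simp add: inj_on_def)
    qed
    have "Q (?\<pi> w) = 1 / (deriv (elem f z0 V) (?\<pi> w))\<^sup>2"
      using V(2) by (intro Qchart[OF V(5,4)]) auto
    then have "h (?\<pi> w) = (deriv (elem f z0 V) (?\<pi> w))\<^sup>2" by (simp add: h_def)
    also have "deriv (elem f z0 V) (?\<pi> w) = deriv (elem f z0 (ball w 1)) (?\<pi> w)"
      using elem_deriv[OF V(1-3) f] elem_deriv[OF open_ball _ inj f] by simp
    finally show ?thesis .
  qed
  show ?thesis
  proof (intro exI[of _ r] exI[of _ h] conjI allI impI)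
    show "zorder h z0 = -1 \<or> zorder h z0 = -2" using g(3) pole(2) by auto
    show "fls_nth (laurent_expansion h z0) (-2) \<in> \<real>" if "zorder h z0 = -2"
    proof -
      have "n = 2" using that pole(2) by simp
      then show ?thesis using pole(3) g(7) by simp
    qed
  qed (use r hol_h h_elem pole in auto)
qed

end
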